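(* Let $G=(V,E)$ be a finite graph of girth $g \geq 12$ and minimum degree $2$, with $n$ vertices and $m$ edges, and let $\gamma(G)$ denote its domination number. Then $$\gamma(G) \geq \max\left\{\sqrt{n},\ \sqrt{\frac{\lfloor g/3 \rfloor-1}{3}\,m}\right\}.$$
   Context: The domination number $\gamma(G)$ is the minimum cardinality of a set $D \subseteq V$ such that every vertex of $V\setminus D$ is adjacent to some vertex of $D$. The girth of a graph is the length of its shortest cycle. *)

theory Defs
  imports Complex_Main "HOL-Library.Extended_Nat"
begin

definition finite_simple_graph :: "'a set \<Rightarrow> 'a set set \<Rightarrow> bool" where
  "finite_simple_graph V E \<longleftrightarrow> finite V \<and> (\<forall>e\<in>E. e \<subseteq> V \<and> card e = 2)"

definition degree :: "'a set set \<Rightarrow> 'a \<Rightarrow> nat" where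
  "degree E v = card {e \<in> E. v \<in> e}"

(* Meaningful only for finite nonempty V. *)
definition min_degree :: "'a set \<Rightarrow> 'a set set \<Rightarrow> nat" where
  "min_degree V E = Min (degree E ` V)"

(* A cycle is given by the list of its distinct vertices; the first one is not
   repeated at the end, so the length of the list is the length of the cycle. *)
definition is_cycle :: "'a set set \<Rightarrow> 'a list \<Rightarrow> bool" where
  "is_cycle E p \<longleftrightarrow> length p \<ge> 3 \<and> distinct p \<and>
     (\<forall>i. Suc i < length p \<longrightarrow> {p ! i, p ! Suc i} \<in> E) \<and> {last p, hd p} \<in> E"

(* The infimum over the empty set is infinity, so acyclic graphs have girth infinity. *)
definition girth :: "'a set set \<Rightarrow> enat" where
  "girth E = (INF p \<in> {p. is_cycle E p}. enat (length p))"

definition dominating_set :: "'a set \<Rightarrow> 'a set set \<Rightarrow> 'a set \<Rightarrow> bool" where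
  "dominating_set V E D \<longleftrightarrow> D \<subseteq> V \<and> (\<forall>v \<in> V - D. \<exists>u \<in> D. {u, v} \<in> E)"

definition domination_number :: "'a set \<Rightarrow> 'a set set \<Rightarrow> nat" where
  "domination_number V E = Min (card ` {D. dominating_set V E D})"

end

(* Assign to every vertex a dominating vertex, so that a minimum dominating set D
   partitions V into |D| stars. Since the girth exceeds 6, two stars are joined by at
   most one edge; let H be the graph on D obtained by contracting the stars, with A = 2 e(H)
   darts (oriented edges). A cycle of H of length k lifts to a cycle of G of length at most
   3 k. Every leaf of a star has an edge leaving the star, hence |V| - |D| <= A and
   2 m <= 2 (|V| - |D|) + A <= 3 A. As A <= |D| (|D| - 1), this gives n <= |D|^2.

   For the second bound put t = floor(g/6) - 1, so that nonbacktracking walks in H with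
   at most 2 t + 1 edges are injective. H has minimum degree at least 2, so every branch
   leaving an edge uv continues for t vertices, and |D| >= 2 + t (d(u) + d(v) - 2).
   Summing over all darts and using Cauchy-Schwarz gives (t + 1) A <= |D|^2. *)

theory Submission
  imports Defs "HOL-Analysis.Convex"
begin

section \<open>Nonbacktracking walks and the cycles they contain\<close>

fun nbwalk :: "('a \<Rightarrow> 'a \<Rightarrow> bool) \<Rightarrow> 'a list \<Rightarrow> bool" where
  "nbwalk R [] \<longleftrightarrow> True"
| "nbwalk R [x] \<longleftrightarrow> True"
| "nbwalk R [x, y] \<longleftrightarrow> R x y"
| "nbwalk R (x # y # z # zs) \<longleftrightarrow> R x y \<and> x \<noteq> z \<and> nbwalk R (y # z # zs)"

lemma nbwalk_Cons2:
  "nbwalk R (x # y # zs) \<longleftrightarrow> R x y \<and> (zs \<noteq> [] \<longrightarrow> x \<noteq> hd zs) \<and> nbwalk R (y # zs)"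
  by (cases zs) auto

lemma nbwalk_ConsD: "nbwalk R (x # xs) \<Longrightarrow> nbwalk R xs"
  by (cases xs) (auto simp: nbwalk_Cons2)

lemma nbwalk_appendD2: "nbwalk R (xs @ ys) \<Longrightarrow> nbwalk R ys"
  by (induction xs) (auto dest: nbwalk_ConsD)

lemma nbwalk_appendD1: "nbwalk R (xs @ ys) \<Longrightarrow> nbwalk R xs"
proof (induction R xs rule: nbwalk.induct)
  case (3 R x y)
  then show ?case by (cases ys) auto
qed auto

text \<open>The two walks overlap in the edge from \<open>x\<close> to \<open>y\<close>, so every
  three consecutive vertices of the union lie in one of them and nothing has to be checked at the
  seam.\<close>

lemma nbwalk_join:
  "nbwalk R (xs @ [x, y]) \<Longrightarrow> nbwalk R (x # y # ys) \<Longrightarrow> nbwalk R (xs @ x # y # ys)"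
proof (induction xs)
  case (Cons a xs)
  then show ?case
    by (cases xs; cases "tl xs") (auto simp: nbwalk_Cons2)
qed auto

text \<open>With a single shared vertex \<open>y\<close>, the only new triple is
  \<open>last xs\<close>, \<open>y\<close>, \<open>z\<close>; \<open>z \<notin> set xs\<close> is a
  convenient way to exclude turning back there.\<close>

lemma nbwalk_append:
  "nbwalk R (xs @ [y]) \<Longrightarrow> nbwalk R (y # z # zs) \<Longrightarrow> z \<notin> set xs \<Longrightarrow> nbwalk R (xs @ y # z # zs)"
proof (induction xs)
  case (Cons a xs)
  then show ?case
    by (cases xs; cases "tl xs") (auto simp: nbwalk_Cons2)
qed auto

lemma nbwalk_rev:
  assumes "symp R" "nbwalk R xs"
  shows "nbwalk R (rev xs)"
  using assms(2)
proof (induction xs rule: induct_list012)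
  case (3 x y zs)
  then have rest: "nbwalk R (rev zs @ [y])" "nbwalk R (y # zs)" "R x y"
    by (auto simp: nbwalk_Cons2)
  show ?case
  proof (cases zs)
    case Nil
    then show ?thesis using rest(3) assms(1) by (auto dest: sympD)
  next
    case (Cons z zs')
    then have "nbwalk R (rev zs' @ z # y # [x])"
      using rest 3 assms(1) by - (rule nbwalk_join, auto simp: nbwalk_Cons2 dest: sympD)
    then show ?thesis using Cons by simp
  qed
qed auto

lemma nbwalk_nth: "nbwalk R xs \<Longrightarrow> Suc i < length xs \<Longrightarrow> R (xs ! i) (xs ! Suc i)"
proof (induction xs arbitrary: i)
  case (Cons a xs)
  then show ?case
    by (cases xs; cases i) (auto simp: nbwalk_Cons2)
qed auto

lemma nbwalk_last: "nbwalk R (xs @ [x]) \<Longrightarrow> xs \<noteq> [] \<Longrightarrow> R (last xs) x"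
  using nbwalk_appendD2[of R "butlast xs" "[last xs, x]"]
  by (metis append.assoc append_Cons append_Nil append_butlast_last_id nbwalk.simps(3))

text \<open>A repeated vertex cuts out a closed segment. If its vertices are otherwise distinct it
  is a cycle; if not, it contains a shorter walk with a repetition. The bound is strict because a
  cycle does not list its first vertex again.\<close>

lemma nbwalk_cycle:
  assumes irr: "\<And>x. {x} \<notin> E"
    and "nbwalk (\<lambda>x y. {x, y} \<in> E) xs" "\<not> distinct xs"
  shows "\<exists>p. is_cycle E p \<and> length p < length xs"
  using assms(2,3)
proof (induction "length xs" arbitrary: xs rule: less_induct)
  case less
  let ?R = "\<lambda>x y. {x, y} \<in> E"
  obtain as x bs cs where xs: "xs = as @ [x] @ bs @ [x] @ cs"
    using not_distinct_decomp[OF less.prems(2)] by blast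
  have walk: "nbwalk ?R ((x # bs) @ [x])"
    using less.prems(1) nbwalk_appendD2[of ?R as "((x # bs) @ [x]) @ cs"] nbwalk_appendD1
    unfolding xs by fastforce
  show ?case
  proof (cases "distinct (x # bs)")
    case True
    \<comment> \<open>An empty \<open>bs\<close> would be a loop, and a single vertex in
      \<open>bs\<close> would mean turning back at once.\<close>
    have "length (x # bs) \<ge> 3"
      using walk irr by (cases bs; cases "tl bs") (auto simp: nbwalk_Cons2)
    moreover have "{(x # bs) ! i, (x # bs) ! Suc i} \<in> E" if "Suc i < length (x # bs)" for i
      using nbwalk_nth[OF nbwalk_appendD1[OF walk] that] .
    moreover have "{last (x # bs), hd (x # bs)} \<in> E"
      using nbwalk_last[OF walk] by simp
    ultimately have "is_cycle E (x # bs)"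
      using True unfolding is_cycle_def by blast
    then show ?thesis using xs by force
  next
    case False
    obtain p where "is_cycle E p" "length p < length (x # bs)"
      using less.hyps[OF _ nbwalk_appendD1[OF walk] False] xs by auto
    then show ?thesis using xs by force
  qed
qed

section \<open>Counting vertices and darts of a relation without short cycles\<close>

(* The bound t on walk lengths stands for girth at least 2 t + 2; lengths of lists count
   vertices, not edges. *)
locale sparse_relation =
  fixes D :: "'a set" and R :: "'a \<Rightarrow> 'a \<Rightarrow> bool" and t :: nat
  assumes fin: "finite D"
    and sym: "symp R"
    and dom: "R x y \<Longrightarrow> x \<in> D"
    and two_nbrs: "x \<in> D \<Longrightarrow> 2 \<le> card {y. R x y}"
    and inj: "nbwalk R xs \<Longrightarrow> length xs \<le> 2 * t + 2 \<Longrightarrow> distinct xs"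
begin

abbreviation "deg x \<equiv> card {y. R x y}"

abbreviation "darts \<equiv> {(x, y). R x y}"

lemma R_sym: "R x y \<Longrightarrow> R y x"
  using sym by (rule sympD)

lemma finite_nbrs: "finite {y. R x y}"
  by (rule finite_subset[OF _ fin]) (auto dest: R_sym dom)

lemma darts_Sigma: "darts = (SIGMA x:D. {y. R x y})"
  by (auto dest: dom)

lemma finite_darts: "finite darts"
  unfolding darts_Sigma using fin finite_nbrs by (intro finite_SigmaI)

lemma card_darts: "card darts = (\<Sum>x\<in>D. deg x)"
  unfolding darts_Sigma using fin finite_nbrs by (intro card_SigmaI) auto

text \<open>A walk entering \<open>b\<close> from \<open>a\<close> can always go on, since
  \<open>b\<close> has a second neighbour.\<close>

lemma ex_extension:
  "R a b \<Longrightarrow> \<exists>ws. length ws = l \<and> nbwalk R (a # b # ws)"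
proof (induction l arbitrary: a b)
  case (Suc l)
  have "\<not> {y. R b y} \<subseteq> {a}"
    using two_nbrs[OF dom[OF R_sym[OF Suc.prems]]] card_mono[of "{a}" "{y. R b y}"] by auto
  then obtain c where c: "R b c" "c \<noteq> a" by auto
  obtain ws where "length ws = l" "nbwalk R (b # c # ws)"
    using Suc.IH[OF c(1)] by blast
  then show ?case
    using c Suc.prems by (intro exI[of _ "c # ws"]) auto
qed auto

text \<open>Any two branches leaving the edge are joined through \<open>u\<close>, \<open>v\<close>
  or both into one nonbacktracking walk, short enough for \<open>inj\<close> to make them disjoint.
  Each has \<open>t\<close> vertices, and the 2 counts \<open>u\<close> and
  \<open>v\<close>.\<close>

lemma card_tree:
  assumes "R u v" "t \<ge> 1"
  shows "2 + t * (deg u - 1 + (deg v - 1)) \<le> card D"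
proof -
  \<comment> \<open>The continuation of the branch that leaves \<open>a\<close> through
    \<open>b\<close>; together with \<open>b\<close> it has \<open>t\<close> vertices.\<close>
  define W where "W a b = (SOME ws. length ws = t - 1 \<and> nbwalk R (a # b # ws))" for a b
  have W: "length (W a b) = t - 1" "nbwalk R (a # b # W a b)" if "R a b" for a b
    using someI_ex[OF ex_extension[OF that]] unfolding W_def by blast+
  have WD: "set (b # W a b) \<subseteq> D" if "R a b" for a b
  proof
    fix z assume "z \<in> set (b # W a b)"
    then obtain i where "i < length (b # W a b)" "z = (b # W a b) ! i"
      by (metis in_set_conv_nth)
    then have "R ((a # b # W a b) ! i) z"
      using nbwalk_nth[OF W(2)[OF that], of i] by simp
    then show "z \<in> D" using dom R_sym by blast
  qed
  \<comment> \<open>A branch is recorded by its end of the edge and its first vertex.\<close>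
  define B where "B = {u} \<times> ({y. R u y} - {v}) \<union> {v} \<times> ({y. R v y} - {u})"
  have uv: "u \<noteq> v"
    using inj[of "[u, v]"] assms(1) by auto
  have B_cases: "(a = u \<and> b \<noteq> v \<or> a = v \<and> b \<noteq> u) \<and> R a b" if "(a, b) \<in> B" for a b
    using that unfolding B_def by auto
  have finB: "finite B"
    unfolding B_def using finite_nbrs by auto
  have cardB: "card B = deg u - 1 + (deg v - 1)"
    unfolding B_def using uv finite_nbrs assms(1) R_sym[OF assms(1)]
    by (subst card_Un_disjoint) (auto simp: card_cartesian_product)
  \<comment> \<open>Up one branch, through \<open>a\<close>, down the other: 2 t + 1
    vertices.\<close>
  have fork: "set (b # W a b) \<inter> set (b' # W a b') = {}"
    if "R a b" "R a b'" "b \<noteq> b'" for a b b'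
  proof -
    have "nbwalk R (rev (W a b) @ [b, a])"
      using nbwalk_rev[OF sym W(2)[OF that(1)]] by simp
    then have "nbwalk R (rev (W a b) @ b # a # b' # W a b')"
      using W(2)[OF that(2)] that R_sym[OF that(1)] by - (rule nbwalk_join, auto)
    then have "distinct (rev (W a b) @ b # a # b' # W a b')"
      using W(1)[OF that(1)] W(1)[OF that(2)] assms(2) by (intro inj) auto
    then show ?thesis by auto
  qed
  \<comment> \<open>Here the walk crosses both \<open>u\<close> and \<open>v\<close> and has 2 t + 2
    vertices, exactly the range of \<open>inj\<close>.\<close>
  have across: "set (b # W u b) \<inter> set (b' # W v b') = {}"
    if "R u b" "R v b'" "b \<noteq> v" "b' \<noteq> u" for b b'
  proof -
    have "nbwalk R (rev (W u b) @ [b, u])"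
      using nbwalk_rev[OF sym W(2)[OF that(1)]] by simp
    then have "nbwalk R (rev (W u b) @ b # u # v # b' # W v b')"
      using W(2)[OF that(2)] that R_sym[OF that(1)] assms(1) by - (rule nbwalk_join, auto)
    then have "distinct (rev (W u b) @ b # u # v # b' # W v b')"
      using W(1)[OF that(1)] W(1)[OF that(2)] assms(2) by (intro inj) auto
    then show ?thesis by auto
  qed
  have root: "distinct (o' # a # b # W a b)" if "R a b" "R o' a" "b \<noteq> o'" for o' a b
    using W[OF that(1)] that assms(2) by (intro inj) auto
  let ?T = "\<lambda>(a, b). set (b # W a b)"
  have disj: "?T p \<inter> ?T q = {}" if "p \<in> B" "q \<in> B" "p \<noteq> q" for p q
  proof -
    obtain a b a' b' where pq: "p = (a, b)" "q = (a', b')" by fastforce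
    show ?thesis
      using B_cases[of a b] B_cases[of a' b'] that fork[of a b b'] across[of b b'] across[of b' b]
      unfolding pq by blast
  qed
  have card_T: "card (?T p) = t" if "p \<in> B" for p
  proof -
    obtain a b where p: "p = (a, b)" by fastforce
    have R: "R a b" using B_cases that p by blast
    have "distinct (a # b # W a b)"
      using W[OF R] assms(2) by (intro inj) auto
    then show ?thesis
      using W(1)[OF R] assms(2) unfolding p by (simp add: distinct_card)
  qed
  have "card (\<Union>p\<in>B. ?T p) = (\<Sum>p\<in>B. card (?T p))"
    using finB disj by (intro card_UN_disjoint) auto
  also have "\<dots> = t * card B"
    using card_T by simp
  finally have T: "card (\<Union>p\<in>B. ?T p) = t * card B" .
  have notin: "{u, v} \<inter> (\<Union>p\<in>B. ?T p) = {}"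
  proof -
    have "u \<notin> set (b # W a b) \<and> v \<notin> set (b # W a b)" if "(a, b) \<in> B" for a b
      using B_cases[OF that] root[of a b u] root[of a b v] assms(1) R_sym[OF assms(1)] by auto
    then show ?thesis by auto
  qed
  have fT: "finite (\<Union>p\<in>B. ?T p)"
    using finB by auto
  have "2 + t * card B = card ({u, v} \<union> (\<Union>p\<in>B. ?T p))"
    using notin uv T fT by (subst card_Un_disjoint) auto
  also have "\<dots> \<le> card D"
  proof (rule card_mono[OF fin])
    have "u \<in> D" "v \<in> D" using dom[OF assms(1)] dom[OF R_sym[OF assms(1)]] by auto
    moreover have "?T p \<subseteq> D" if "p \<in> B" for p
      using that B_cases WD by (cases p) blast
    ultimately show "{u, v} \<union> (\<Union>p\<in>B. ?T p) \<subseteq> D" by blast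
  qed
  finally show ?thesis using cardB by simp
qed

lemma sum_darts_fst: "(\<Sum>(x, y)\<in>darts. real (deg x)) = (\<Sum>x\<in>D. real (deg x) ^ 2)"
  unfolding darts_Sigma using fin finite_nbrs
  by (subst sum.Sigma[symmetric]) (auto simp: power2_eq_square)

lemma sum_darts_snd: "(\<Sum>(x, y)\<in>darts. real (deg y)) = (\<Sum>x\<in>D. real (deg x) ^ 2)"
proof -
  have "(\<Sum>(x, y)\<in>darts. real (deg y)) = (\<Sum>(x, y)\<in>darts. real (deg x))"
    by (rule sum.reindex_bij_witness[of _ prod.swap prod.swap]) (auto dest: R_sym)
  then show ?thesis using sum_darts_fst by simp
qed

text \<open>Averaging \<open>card_tree\<close> over the darts and applying Cauchy-Schwarz gives 2 T
  A \<le> N (N + 2 T - 2). The lower bound N \<ge> 2 T + 2, from any single dart, then absorbs the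
  term 2 T - 2.\<close>

lemma card_darts_sparse:
  assumes "t \<ge> 1"
  shows "(t + 1) * card darts \<le> (card D)\<^sup>2"
proof (cases "darts = {}")
  case False
  define N where "N = real (card D)"
  define A where "A = real (card darts)"
  define Q where "Q = (\<Sum>x\<in>D. real (deg x) ^ 2)"
  define T where "T = real t"
  have T: "T \<ge> 1" using assms T_def by simp
  have A: "A > 0"
    unfolding A_def using False finite_darts by (simp add: card_gt_0_iff)
  have bound: "2 + T * (real (deg u) + real (deg v) - 2) \<le> N" if "R u v" for u v
  proof -
    have d: "2 \<le> deg u" "2 \<le> deg v" using that two_nbrs dom R_sym by blast+
    have "real (2 + t * (deg u - 1 + (deg v - 1))) \<le> N"
      unfolding N_def using card_tree[OF that assms] of_nat_le_iff by blast
    moreover have "real (deg u - 1 + (deg v - 1)) = real (deg u) + real (deg v) - 2"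
      using d by linarith
    ultimately show ?thesis unfolding T_def by simp
  qed
  obtain u v where uv: "R u v" using False by auto
  have N: "2 * T + 2 \<le> N"
  proof -
    have "2 \<le> deg u" "2 \<le> deg v" using uv two_nbrs dom R_sym by blast+
    then have "T * 2 \<le> T * (real (deg u) + real (deg v) - 2)"
      using T by (intro mult_left_mono) auto
    then show ?thesis using bound[OF uv] by simp
  qed
  \<comment> \<open>Each vertex \<open>x\<close> starts \<open>deg x\<close> darts and ends as many,
    so both degree sums over the darts equal \<open>Q\<close>.\<close>
  have "A * 2 + T * (2 * Q - 2 * A) = (\<Sum>(u, v)\<in>darts. 2 + T * (real (deg u) + real (deg v) - 2))"
  proof -
    have "(\<Sum>(u, v)\<in>darts. 2 + T * (real (deg u) + real (deg v) - 2)) =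
        (\<Sum>p\<in>darts. (2 - 2 * T) + T * real (deg (fst p)) + T * real (deg (snd p)))"
      by (intro sum.cong) (auto simp: algebra_simps)
    also have "\<dots> = A * (2 - 2 * T) + T * (\<Sum>p\<in>darts. real (deg (fst p)))
        + T * (\<Sum>p\<in>darts. real (deg (snd p)))"
      by (simp add: sum.distrib sum_distrib_left A_def)
    also have "\<dots> = A * 2 + T * (2 * Q - 2 * A)"
      using sum_darts_fst sum_darts_snd by (simp add: case_prod_beta Q_def algebra_simps)
    finally show ?thesis by simp
  qed
  also have "\<dots> \<le> (\<Sum>p\<in>darts. N)"
    using bound by (intro sum_mono) auto
  also have "\<dots> = A * N" by (simp add: A_def)
  finally have sumb: "A * 2 + T * (2 * Q - 2 * A) \<le> A * N" .
  \<comment> \<open>Cauchy-Schwarz, as \<open>A\<close> is the sum of the \<open>N\<close>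
    degrees.\<close>
  have "A\<^sup>2 \<le> N * Q"
    using sum_squared_le_sum_of_squares[of "\<lambda>x. real (deg x)" D]
    unfolding A_def N_def Q_def card_darts by (simp add: mult.commute)
  then have "2 * T * A\<^sup>2 \<le> 2 * T * (N * Q)"
    using T by (intro mult_left_mono) auto
  also have "\<dots> \<le> N * (A * N + 2 * T * A - 2 * A)"
    using mult_left_mono[OF sumb, of N] N T by (simp add: algebra_simps)
  finally have "A * (2 * T * A) \<le> A * (N * (N + 2 * T - 2))"
    by (simp add: algebra_simps power2_eq_square)
  then have "2 * T * A \<le> N * (N + 2 * T - 2)"
    using A by simp
  then have "(T + 1) * (2 * T * A) \<le> (T + 1) * (N * (N + 2 * T - 2))"
    using T by (intro mult_left_mono) auto
  also have "\<dots> \<le> 2 * T * N\<^sup>2"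
  proof -
    \<comment> \<open>This product is exactly the difference of the two sides.\<close>
    have "0 \<le> (T - 1) * N * (N - (2 * T + 2))"
      using T N by (intro mult_nonneg_nonneg) auto
    then show ?thesis by (simp add: algebra_simps power2_eq_square)
  qed
  finally have "2 * T * ((T + 1) * A) \<le> 2 * T * N\<^sup>2" by (simp add: algebra_simps)
  then have "(T + 1) * A \<le> N\<^sup>2" using T by simp
  then have "real ((t + 1) * card darts) \<le> real ((card D)\<^sup>2)"
    unfolding T_def A_def N_def by (simp add: algebra_simps)
  then show ?thesis using of_nat_le_iff by blast
qed simp

text \<open>Applied to two-vertex walks, \<open>inj\<close> excludes loops, so the darts avoid the
  diagonal of D \<times> D.\<close>

lemma card_darts_le: "card darts + card D \<le> (card D)\<^sup>2"
proof -
  have "x \<noteq> y" if "R x y" for x y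
    using inj[of "[x, y]"] that by auto
  then have "darts \<inter> (\<lambda>x. (x, x)) ` D = {}" by auto
  then have "card darts + card D = card (darts \<union> (\<lambda>x. (x, x)) ` D)"
    using finite_darts fin by (subst card_Un_disjoint) (auto simp: card_image inj_on_def)
  also have "\<dots> \<le> card (D \<times> D)"
    using fin by (intro card_mono) (auto dest: dom R_sym)
  finally show ?thesis by (simp add: power2_eq_square card_cartesian_product)
qed

end

section \<open>The partition into stars and the contracted graph\<close>

text \<open>\<open>f\<close> sends every vertex to the centre of its star. Of the girth only the
  lower bound \<open>g\<close> on cycle lengths is recorded.\<close>

locale star_partition =
  fixes V :: "'a set" and E :: "'a set set" and D :: "'a set" and f :: "'a \<Rightarrow> 'a" and g :: nat
  assumes graph: "finite_simple_graph V E"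
    and centre: "x \<in> V \<Longrightarrow> f x \<in> D"
    and DV: "D \<subseteq> V"
    and f_D: "x \<in> D \<Longrightarrow> f x = x"
    and spoke: "x \<in> V - D \<Longrightarrow> {x, f x} \<in> E"
    and two_nbrs: "x \<in> V \<Longrightarrow> 2 \<le> degree E x"
    and g12: "12 \<le> g"
    and girth_le: "is_cycle E p \<Longrightarrow> g \<le> length p"
begin

abbreviation "adj x y \<equiv> {x, y} \<in> E"

text \<open>The graph H obtained by contracting the stars; \<open>c \<noteq> d\<close> discards the
  edges inside a star.\<close>

definition quot :: "'a \<Rightarrow> 'a \<Rightarrow> bool" where
  "quot c d \<longleftrightarrow> c \<noteq> d \<and> (\<exists>x y. adj x y \<and> f x = c \<and> f y = d)"

lemma finV: "finite V"
  using graph by (simp add: finite_simple_graph_def)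

lemma adjV: "adj x y \<Longrightarrow> x \<in> V \<and> y \<in> V \<and> x \<noteq> y"
  using graph unfolding finite_simple_graph_def by fastforce

lemma adj_sym: "adj x y \<Longrightarrow> adj y x"
  by (simp add: insert_commute)

lemma finE: "finite E"
  using graph finV unfolding finite_simple_graph_def
  by (intro finite_subset[of E "Pow V"]) auto

lemma f_f: "x \<in> V \<Longrightarrow> f (f x) = f x"
  using centre f_D by simp

lemma adj_f: "x \<in> V \<Longrightarrow> f x \<noteq> x \<Longrightarrow> adj x (f x) \<and> adj (f x) x"
  using spoke[of x] f_D[of x] adj_sym by blast

text \<open>The source of all contradictions with the girth: a short nonbacktracking walk cannot
  repeat a vertex.\<close>

lemma nbwalk_length:
  assumes "nbwalk adj xs" "\<not> distinct xs"
  shows "g < length xs"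
proof -
  have "{x} \<notin> E" for x
    using graph unfolding finite_simple_graph_def by fastforce
  then show ?thesis
    using nbwalk_cycle[OF _ assms] girth_le by fastforce
qed

text \<open>Two adjacent leaves would form a triangle with their centre.\<close>

lemma adj_within_star:
  assumes "adj x y" "f x = f y"
  shows "x = f x \<or> y = f x"
proof (rule ccontr)
  assume *: "\<not> ?thesis"
  then have "nbwalk adj [x, f x, y, x]"
    using assms adj_f[of x] adj_f[of y] adjV[of x y] adj_sym[of x y] by auto
  then show False
    using nbwalk_length[of "[x, f x, y, x]"] g12 by simp
qed

text \<open>The route goes directly or through the centre. Knowing that \<open>ws\<close> stays in
  the star lets turning back be excluded by comparing values of \<open>f\<close>.\<close>

lemma star_path:
  assumes "x \<in> V" "y \<in> V" "f x = f y" "x \<noteq> y"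
  obtains ws where "nbwalk adj (x # ws @ [y])" "length ws \<le> 1" "\<forall>w\<in>set ws. f w = f x"
proof (cases "f x = x \<or> f x = y")
  case True
  then have "nbwalk adj (x # [] @ [y])"
    using assms adj_f[of x] adj_f[of y] by auto
  then show ?thesis using that[of "[]"] by auto
next
  case False
  then have "nbwalk adj (x # [f x] @ [y])"
    using assms adj_f[of x] adj_f[of y] by auto
  then show ?thesis using that[of "[f x]"] f_f assms by auto
qed

text \<open>Two such edges, closed up by \<open>star_path\<close> inside the stars, would give a
  cycle of length at most 6.\<close>

lemma edge_between_stars_unique:
  assumes e: "adj x y" "adj x' y'" "f x = f x'" "f y = f y'" "f x \<noteq> f y"
  shows "x = x' \<and> y = y'"
proof -
  \<comment> \<open>Edges with a common end are treated first, because \<open>star_path\<close>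
    needs distinct ends in each star.\<close>
  have *: "y = y'" if e: "adj x y" "adj x y'" "f y = f y'" "f x \<noteq> f y" for x y y'
  proof (rule ccontr)
    assume "y \<noteq> y'"
    have "y \<in> V" "y' \<in> V" using e adjV by blast+
    obtain ws where ws: "nbwalk adj (y # ws @ [y'])" "length ws \<le> 1"
      "\<forall>w\<in>set ws. f w = f y"
      using star_path[OF \<open>y \<in> V\<close> \<open>y' \<in> V\<close> e(3) \<open>y \<noteq> y'\<close>] by blast
    have "nbwalk adj (y # ws @ [y', x, y])"
      using nbwalk_append[of adj "y # ws" y' x "[y]"] ws(1,3) e \<open>y \<noteq> y'\<close> adj_sym[of x y']
      by auto
    then show False
      using nbwalk_length[of "y # ws @ [y', x, y]"] ws(2) g12 by simp
  qed
  consider "x = x'" | "y = y'" | "x \<noteq> x'" "y \<noteq> y'" by blast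
  then show ?thesis
  proof cases
    case 1
    then show ?thesis using *[of x y y'] e by simp
  next
    case 2
    then show ?thesis using *[of y x x'] e adj_sym[of x y] adj_sym[of x' y'] by simp
  next
    case 3
    have V: "x \<in> V" "x' \<in> V" "y \<in> V" "y' \<in> V" using e adjV by blast+
    obtain ws where ws: "nbwalk adj (y # ws @ [y'])" "length ws \<le> 1"
      "\<forall>w\<in>set ws. f w = f y"
      using star_path[OF V(3,4) e(4) 3(2)] by blast
    obtain vs where vs: "nbwalk adj (x' # vs @ [x])" "length vs \<le> 1"
      "\<forall>w\<in>set vs. f w = f x'"
      using star_path[OF V(2,1) e(3)[symmetric] 3(1)[symmetric]] by blast
    have "y \<notin> set (x' # vs)" "y' \<notin> set (x' # vs)" "y' \<noteq> x" "x' \<notin> set (y # ws)"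
      using ws(3) vs(3) e(3-5) by auto
    moreover from this have "nbwalk adj (x' # vs @ [x, y])"
      using nbwalk_append[of adj "x' # vs" x y "[]"] vs(1) e(1) by simp
    ultimately have "nbwalk adj (y' # x' # vs @ [x, y])"
      using adj_sym[OF e(2)] by (cases vs) auto
    then have "nbwalk adj (y # ws @ [y', x'] @ vs @ [x, y])"
      using nbwalk_append[of adj "y # ws" y' x' "vs @ [x, y]"] ws(1) \<open>x' \<notin> set (y # ws)\<close> by simp
    then show ?thesis
      using nbwalk_length[of "y # ws @ [y', x'] @ vs @ [x, y]"] ws(2) vs(2) g12 by simp
  qed
qed

section \<open>Lifting walks from the contracted graph\<close>

text \<open>Each further vertex of the walk in H costs at most three vertices: one to cross the
  current star, and the two ends of the next edge between stars. The final + 1 allows a last step to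
  the centre. The first lifted edge is prescribed so that the induction can glue.\<close>

lemma quot_lift:
  assumes "nbwalk quot (c # d # ds)" "adj x y" "f x = c" "f y = d"
  shows "\<exists>ws. nbwalk adj (x # y # ws) \<and> last (y # ws) = last (d # ds) \<and>
    length ws \<le> 3 * length ds + 1"
  using assms
proof (induction ds arbitrary: c d x y)
  case Nil
  then have cd: "c \<noteq> d" by (simp add: quot_def)
  show ?case
  proof (cases "y = d")
    case True
    then show ?thesis using Nil by (intro exI[of _ "[]"]) auto
  next
    case False
    then show ?thesis
      using Nil cd adj_f[of y] f_f adjV by (intro exI[of _ "[d]"]) auto
  qed
next
  case (Cons e ds)
  have walk: "nbwalk quot (d # e # ds)" and "quot c d" "quot d e" "c \<noteq> e"
    using Cons.prems(1) by (auto simp: nbwalk_Cons2)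
  then have ne: "c \<noteq> d" "d \<noteq> e" "c \<noteq> e"
    by (auto simp: quot_def)
  obtain x' y' where xy': "adj x' y'" "f x' = d" "f y' = e"
    using \<open>quot d e\<close> by (auto simp: quot_def)
  obtain ws where ws: "nbwalk adj (x' # y' # ws)" "last (y' # ws) = last (e # ds)"
    "length ws \<le> 3 * length ds + 1"
    using Cons.IH[OF walk xy'] by blast
  show ?case
  proof (cases "y = x'")
    \<comment> \<open>The lifted edges meet directly; \<open>x \<noteq> y'\<close> holds because
      their stars \<open>c\<close> and \<open>e\<close> differ, as the walk in H does not turn
      back.\<close>
    case True
    then show ?thesis
      using Cons.prems ne xy' ws by (intro exI[of _ "y' # ws"]) auto
  next
    case False
    have "y \<in> V" "x' \<in> V" "f y = f x'" using Cons.prems xy' adjV by auto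
    then obtain us where us: "nbwalk adj (y # us @ [x'])" "length us \<le> 1"
      "\<forall>w\<in>set us. f w = d"
      using star_path[of y x'] False Cons.prems(4) by metis
    have "nbwalk adj (x # y # us @ x' # y' # ws)"
    proof -
      have "y' \<notin> set (y # us)" "x \<notin> set us" "x \<noteq> x'"
        using us(3) Cons.prems(3,4) ne xy' by auto
      then have "nbwalk adj (y # us @ x' # y' # ws)" "x \<noteq> hd (us @ x' # y' # ws)"
        using nbwalk_append[of adj "y # us" x' y' ws] us(1) ws(1) by (cases us; simp)+
      then show ?thesis using Cons.prems(2) by (simp add: nbwalk_Cons2)
    qed
    then show ?thesis
      using us ws by (intro exI[of _ "us @ x' # y' # ws"]) auto
  qed
qed

text \<open>The lift ends at the centre \<open>c\<close>. Starting it at \<open>c\<close> too, by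
  prepending the centre if \<open>x\<close> is a leaf, repeats \<open>c\<close> within at most
  \<open>3 * length ds + 4\<close> vertices.\<close>

lemma quot_closed_length:
  assumes "nbwalk quot (c # d # ds)" "last (d # ds) = c"
  shows "g \<le> 3 * (length ds + 1)"
proof -
  have "quot c d" using assms(1) by (simp add: nbwalk_Cons2)
  then obtain x y where xy: "adj x y" "f x = c" "f y = d" "c \<noteq> d"
    by (auto simp: quot_def)
  obtain ws where ws: "nbwalk adj (x # y # ws)" "last (y # ws) = c"
    "length ws \<le> 3 * length ds + 1"
    using quot_lift[OF assms(1) xy(1-3)] assms(2) by auto
  have c: "c \<in> set (y # ws)" using ws(2) last_in_set[of "y # ws"] by auto
  show ?thesis
  proof (cases "x = c")
    case True
    then show ?thesis using nbwalk_length[OF ws(1)] ws(3) c by auto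
  next
    case False
    then have "nbwalk adj (c # x # y # ws)"
      using ws(1) xy adj_f[of x] f_f[of x] adjV[of x y] by (auto simp: nbwalk_Cons2)
    then show ?thesis using nbwalk_length[of "c # x # y # ws"] ws(3) c by auto
  qed
qed

text \<open>A repetition yields a closed subwalk with at most \<open>length xs - 1\<close> edges, to
  which \<open>quot_closed_length\<close> applies.\<close>

lemma nbwalk_quot_distinct:
  assumes "nbwalk quot xs" "3 * (length xs - 1) < g"
  shows "distinct xs"
proof (rule ccontr)
  assume "\<not> distinct xs"
  then obtain as x bs cs where xs: "xs = as @ [x] @ bs @ [x] @ cs"
    using not_distinct_decomp by blast
  have walk: "nbwalk quot (x # bs @ [x])"
    using assms(1) nbwalk_appendD2[of quot as "(x # bs @ [x]) @ cs"] nbwalk_appendD1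
    unfolding xs by fastforce
  show False
  proof (cases bs)
    case Nil
    then show ?thesis using walk by (simp add: quot_def)
  next
    case (Cons b bs')
    then show ?thesis
      using quot_closed_length[of x b "bs' @ [x]"] walk assms(2) xs by auto
  qed
qed

section \<open>Degrees in the contracted graph\<close>

lemma degree_card_nbrs: "degree E x = card {y. adj x y}"
proof -
  have "bij_betw (\<lambda>y. {x, y}) {y. adj x y} {e \<in> E. x \<in> e}"
    unfolding bij_betw_def
  proof
    show "inj_on (\<lambda>y. {x, y}) {y. adj x y}"
      by (auto simp: inj_on_def doubleton_eq_iff)
    show "(\<lambda>y. {x, y}) ` {y. adj x y} = {e \<in> E. x \<in> e}"
    proof (intro equalityI subsetI)
      fix e assume e: "e \<in> {e \<in> E. x \<in> e}"
      then have "card e = 2" using graph by (auto simp: finite_simple_graph_def)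
      then obtain y where "e = {x, y}" using e by (auto simp: card_2_iff)
      then show "e \<in> (\<lambda>y. {x, y}) ` {y. adj x y}" using e by auto
    qed auto
  qed
  then show ?thesis unfolding degree_def by (simp add: bij_betw_same_card)
qed

lemma ex_other_nbr:
  assumes "x \<in> V"
  shows "\<exists>y. adj x y \<and> y \<noteq> z"
proof (rule ccontr)
  assume "\<not> ?thesis"
  then have "{y. adj x y} \<subseteq> {z}" by auto
  then have "card {y. adj x y} \<le> 1" using card_mono[of "{z}"] by auto
  then show False using two_nbrs[OF assms] degree_card_nbrs by simp
qed

definition outer :: "'a \<Rightarrow> 'a" where
  "outer x = (SOME y. adj x y \<and> y \<noteq> f x)"

lemma outer: "x \<in> V \<Longrightarrow> adj x (outer x) \<and> outer x \<noteq> f x"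
  unfolding outer_def by (rule someI_ex) (rule ex_other_nbr)

text \<open>Inside its star a leaf is adjacent to the centre only, and \<open>outer\<close> avoids
  the centre.\<close>

lemma f_outer: "x \<in> V - D \<Longrightarrow> f (outer x) \<noteq> f x"
  using outer[of x] adj_within_star[of x "outer x"] centre[of x] by auto

lemma quot_two_nbrs:
  assumes "d \<in> D"
  shows "2 \<le> card {c. quot d c}"
proof -
  have dV: "d \<in> V" and fd: "f d = d" using assms DV f_D by auto
  obtain a where a: "adj d a" using ex_other_nbr[OF dV] by blast
  obtain b where b: "adj d b" "b \<noteq> a" using ex_other_nbr[OF dV] by blast
  \<comment> \<open>Each neighbour \<open>y\<close> of the centre yields an edge leaving the star:
    the edge from \<open>d\<close> to \<open>y\<close> itself, or the outer edge of \<open>y\<close>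
    if \<open>y\<close> is a leaf of this star.\<close>
  define h where "h y = (if f y = d then (y, outer y) else (d, y))" for y
  have h: "adj (fst (h y)) (snd (h y)) \<and> f (fst (h y)) = d \<and> f (snd (h y)) \<noteq> d" if "adj d y" for y
    using that adjV[OF that] f_outer[of y] outer[of y] f_D[of y] fd unfolding h_def by auto
  have "h a \<noteq> h b"
    using a b adjV[of d a] adjV[of d b] unfolding h_def by auto
  \<comment> \<open>Distinct edges leaving the star end in distinct stars.\<close>
  then have "f (snd (h a)) \<noteq> f (snd (h b))"
    using edge_between_stars_unique[of "fst (h a)" "snd (h a)" "fst (h b)" "snd (h b)"]
      h[OF a] h[OF b(1)] by (metis prod.collapse)
  then have "card {f (snd (h a)), f (snd (h b))} = 2" by simp
  moreover have "{f (snd (h a)), f (snd (h b))} \<subseteq> {c. quot d c}"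
    using h[OF a] h[OF b(1)] unfolding quot_def by blast
  moreover have "finite {c. quot d c}"
    by (rule finite_subset[OF _ finV]) (use adjV centre DV in \<open>auto simp: quot_def\<close>)
  ultimately show ?thesis using card_mono by metis
qed

text \<open>A walk on 2 t + 2 vertices has 2 t + 1 edges, and 3 (2 t + 1) < 6 t + 6.\<close>

lemma sparse_quot:
  assumes "6 * t + 6 \<le> g"
  shows "sparse_relation D quot t"
proof
  show "finite D" using DV finV finite_subset by blast
  show "symp quot" unfolding symp_def quot_def using adj_sym by metis
  show "x \<in> D" if "quot x y" for x y
    using that adjV centre unfolding quot_def by blast
  show "2 \<le> card {y. quot x y}" if "x \<in> D" for x
    using that by (rule quot_two_nbrs)
  show "distinct xs" if "nbwalk quot xs" "length xs \<le> 2 * t + 2" for xs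
    using that assms by (intro nbwalk_quot_distinct) auto
qed

section \<open>Vertices and edges counted by darts of the contracted graph\<close>

abbreviation "quot_darts \<equiv> {(c, d). quot c d}"

lemma finite_quot_darts: "finite quot_darts"
proof (rule finite_subset)
  show "quot_darts \<subseteq> V \<times> V"
    using adjV centre DV unfolding quot_def by blast
qed (use finV in simp)

text \<open>The outer edge of a leaf gives a dart of H, which determines the edge and hence the
  leaf.\<close>

lemma card_V_minus_D: "card (V - D) \<le> card quot_darts"
proof (rule card_inj_on_le[OF _ _ finite_quot_darts])
  show "inj_on (\<lambda>x. (f x, f (outer x))) (V - D)"
  proof (rule inj_onI)
    fix x y assume "x \<in> V - D" "y \<in> V - D" "(f x, f (outer x)) = (f y, f (outer y))"
    then show "x = y"
      using edge_between_stars_unique[of x "outer x" y "outer y"] outer[of x] outer[of y] f_outer[of x]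
      by auto
  qed
  show "(\<lambda>x. (f x, f (outer x))) ` (V - D) \<subseteq> quot_darts"
  proof clarify
    fix x assume "x \<in> V" "x \<notin> D"
    then show "quot (f x) (f (outer x))"
      using outer[of x] f_outer[of x] unfolding quot_def by (metis DiffI)
  qed
qed

lemma card_adj_darts: "card {(x, y). adj x y} = 2 * card E"
proof -
  have "{(x, y). adj x y} = (\<Union>e\<in>E. {(x, y). {x, y} = e})" by auto
  also have "card \<dots> = (\<Sum>e\<in>E. card {(x, y). {x, y} = e})"
  proof (intro card_UN_disjoint finE ballI impI)
    show "finite {(x, y). {x, y} = e}" if "e \<in> E" for e
      by (rule finite_subset[of _ "V \<times> V"]) (use finV adjV that in auto)
  qed auto
  also have "\<dots> = (\<Sum>e\<in>E. 2)"
  proof (intro sum.cong refl)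
    fix e assume "e \<in> E"
    then have "card e = 2" using graph by (auto simp: finite_simple_graph_def)
    then obtain a b where e: "e = {a, b}" "a \<noteq> b" by (auto simp: card_2_iff)
    then have "{(x, y). {x, y} = e} = {(a, b), (b, a)}" by (auto simp: doubleton_eq_iff)
    then show "card {(x, y). {x, y} = e} = 2" using e by simp
  qed
  finally show ?thesis by simp
qed

lemma card_E_le: "2 * card E \<le> 2 * card (V - D) + card quot_darts"
proof -
  \<comment> \<open>\<open>?S\<close> holds the spokes in both directions, \<open>?O\<close> the
    darts between stars; the latter inject into the darts of H.\<close>
  let ?S = "(\<lambda>x. (x, f x)) ` (V - D) \<union> (\<lambda>x. (f x, x)) ` (V - D)"
  let ?O = "{(x, y). adj x y \<and> f x \<noteq> f y}"
  have finO: "finite ?O"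
    by (rule finite_subset[of _ "V \<times> V"]) (use finV adjV in auto)
  have sub: "{(x, y). adj x y} \<subseteq> ?S \<union> ?O"
  proof (rule subrelI)
    fix x y assume "(x, y) \<in> {(x, y). adj x y}"
    then have xy: "adj x y" by simp
    show "(x, y) \<in> ?S \<union> ?O"
    proof (cases "f x = f y")
      case True
      have V: "x \<in> V" "y \<in> V" "x \<noteq> y" using adjV[OF xy] by auto
      consider "x = f x" | "y = f x" using adj_within_star[OF xy True] by blast
      then show ?thesis
      proof cases
        case 1
        then have "y \<in> V - D" "x = f y" using V True f_D[of y] by auto
        then show ?thesis by blast
      next
        case 2
        then have "x \<in> V - D" using V f_D[of x] by auto
        then show ?thesis using 2 by blast
      qed
    qed (use xy in simp)
  qed
  have "2 * card E \<le> card (?S \<union> ?O)"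
    unfolding card_adj_darts[symmetric] using sub finO finV by (intro card_mono) auto
  also have "\<dots> \<le> card ?S + card ?O" by (rule card_Un_le)
  also have "card ?S \<le> card (V - D) + card (V - D)"
    using finV by (intro order.trans[OF card_Un_le] add_mono card_image_le) auto
  also have "card ?O \<le> card quot_darts"
  proof (rule card_inj_on_le[OF _ _ finite_quot_darts])
    show "inj_on (\<lambda>(x, y). (f x, f y)) ?O"
    proof (rule inj_onI, clarify)
      fix x y x' y' assume "adj x y" "adj x' y'" "f x \<noteq> f y" "f x = f x'" "f y = f y'"
      then show "x = x' \<and> y = y'" by (intro edge_between_stars_unique)
    qed
    show "(\<lambda>(x, y). (f x, f y)) ` ?O \<subseteq> quot_darts"
    proof clarify
      fix x y assume "adj x y" "f x \<noteq> f y"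
      then show "quot (f x) (f y)" unfolding quot_def by blast
    qed
  qed
  finally show ?thesis by simp
qed

lemma card_V_le: "card V \<le> (card D)\<^sup>2"
proof -
  interpret sparse_relation D quot 1
    using g12 by (intro sparse_quot) simp
  have "card V = card (V - D) + card D"
    using DV finV fin card_mono[OF finV DV] by (simp add: card_Diff_subset)
  then show ?thesis using card_V_minus_D card_darts_le by simp
qed

lemma card_E_sparse: "(g div 3 - 1) * card E \<le> 3 * (card D)\<^sup>2"
proof -
  \<comment> \<open>The largest \<open>t\<close> with 6 t + 6 \<le> g. Since floor(g/3) \<le> 2
    floor(g/6) + 1, the factor in the bound is at most 2 (t + 1), and 2 m \<le> 3 A
    finishes.\<close>
  define t where "t = g div 6 - 1"
  have t: "1 \<le> t" "6 * t + 6 \<le> g" "g div 3 - 1 \<le> 2 * t + 2"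
    using g12 unfolding t_def by auto
  interpret sparse_relation D quot t
    using t(2) by (rule sparse_quot)
  have "(g div 3 - 1) * card E \<le> (2 * t + 2) * card E"
    using t(3) by (intro mult_right_mono) auto
  also have "\<dots> = (t + 1) * (2 * card E)" by simp
  also have "\<dots> \<le> (t + 1) * (3 * card quot_darts)"
    using card_E_le card_V_minus_D by (intro mult_left_mono) auto
  also have "\<dots> \<le> 3 * (card D)\<^sup>2"
    using card_darts_sparse[OF t(1)] by simp
  finally show ?thesis .
qed

end

section \<open>The domination number and the two bounds\<close>

text \<open>\<open>V\<close> dominates itself, so the minimum is over a nonempty finite set.\<close>

lemma domination_number_attained:
  assumes "finite V"
  obtains D where "dominating_set V E D" "domination_number V E = card D"
proof -
  have "finite {D. dominating_set V E D}"
    by (rule finite_subset[of _ "Pow V"]) (use assms in \<open>auto simp: dominating_set_def\<close>)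
  moreover have "V \<in> {D. dominating_set V E D}"
    by (auto simp: dominating_set_def)
  ultimately have "domination_number V E \<in> card ` {D. dominating_set V E D}"
    unfolding domination_number_def by (intro Min_in) auto
  then show ?thesis using that by auto
qed

theorem theorem3:
  fixes V :: "'a set" and E :: "'a set set" and g n m :: nat
  assumes "finite_simple_graph V E"
    and "girth E = enat g" and "g \<ge> 12"
    and "min_degree V E \<ge> 2"
    and "n = card V" and "m = card E"
  shows "real (domination_number V E)
     \<ge> max (sqrt (real n)) (sqrt ((real_of_int \<lfloor>real g / 3\<rfloor> - 1) / 3 * real m))"
proof -
  have finV: "finite V" using assms(1) by (simp add: finite_simple_graph_def)
  obtain D where D: "dominating_set V E D" "domination_number V E = card D"
    using domination_number_attained[OF finV] .
  \<comment> \<open>Members of \<open>D\<close> are their own centres; every other vertex picks one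
    dominating neighbour.\<close>
  define f where "f x = (if x \<in> D then x else SOME u. u \<in> D \<and> {u, x} \<in> E)" for x
  have f: "f x \<in> D \<and> {f x, x} \<in> E" if "x \<in> V - D" for x
  proof -
    have "\<exists>u. u \<in> D \<and> {u, x} \<in> E" using D(1) that unfolding dominating_set_def by blast
    from someI_ex[OF this] show ?thesis using that unfolding f_def by auto
  qed
  interpret star_partition V E D f g
  proof
    show "f x \<in> D" if "x \<in> V" for x
      using f[of x] that by (cases "x \<in> D") (auto simp: f_def)
    show "D \<subseteq> V" using D(1) by (simp add: dominating_set_def)
    show "{x, f x} \<in> E" if "x \<in> V - D" for x
      using f[OF that] by (simp add: insert_commute)
    show "2 \<le> degree E x" if "x \<in> V" for x
    proof -
      have "min_degree V E \<le> degree E x"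
        unfolding min_degree_def using finV that by (intro Min_le) auto
      then show ?thesis using assms(4) by simp
    qed
    show "g \<le> length p" if "is_cycle E p" for p
    proof -
      have "girth E \<le> enat (length p)"
        unfolding girth_def by (rule INF_lower) (simp add: that)
      then show ?thesis using assms(2) by simp
    qed
  qed (use assms in \<open>auto simp: f_def\<close>)
  have "sqrt (real n) \<le> card D"
    using card_V_le unfolding assms(5)
    by (intro real_le_lsqrt) (auto simp flip: of_nat_power)
  moreover have "sqrt ((real_of_int \<lfloor>real g / 3\<rfloor> - 1) / 3 * real m) \<le> card D"
  proof (intro real_le_lsqrt)
    have "\<lfloor>real g / 3\<rfloor> = int (g div 3)"
      using floor_divide_of_nat_eq[of g 3] by simp
    \<comment> \<open>The natural-number subtraction is not truncated, since
      \<open>g \<ge> 12\<close>.\<close>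
    then have "real_of_int \<lfloor>real g / 3\<rfloor> - 1 = real (g div 3 - 1)"
      using g12 by (simp add: of_nat_diff)
    moreover have "real ((g div 3 - 1) * card E) \<le> real (3 * (card D)\<^sup>2)"
      using card_E_sparse of_nat_le_iff by blast
    ultimately show "(real_of_int \<lfloor>real g / 3\<rfloor> - 1) / 3 * real m \<le> (real (card D))\<^sup>2"
      unfolding assms(6) by simp
  qed auto
  ultimately show ?thesis using D(2) by simp
qed

end
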